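(* Let $p$ be a prime number and let $(R,Q,\alpha)$ be a prelog ring. Then the functor $M\mapsto F\mathrm{Der}_{(R,Q,\alpha)}(M)$ on the category of $R$-modules is representable by a universal log FW-derivation: there exist an $R$-module $F\Omega_{(R,Q,\alpha)}$ and a log FW-derivation $(w\colon R\to F\Omega_{(R,Q,\alpha)},\ w\log\colon Q\to F\Omega_{(R,Q,\alpha)})$ of $(R,Q,\alpha)$ such that for every $R$-module $M$ the map $$\mathrm{Hom}_R(F\Omega_{(R,Q,\alpha)},M)\to F\mathrm{Der}_{(R,Q,\alpha)}(M),\qquad u\mapsto (u\circ w,\ u\circ w\log)$$ is an isomorphism.
   Context: All rings and monoids are commutative with unity, and homomorphisms preserve the unity. A ring regarded as a monoid is regarded via its multiplication. A prelog ring $(R,Q,\alpha)$ is a ring $R$, a monoid $Q$, and a monoid homomorphism $\alpha\colon Q\to R$. Let $P(X,Y)=\sum_{i=1}^{p-1}\frac{(p-1)!}{i!(p-i)!}X^iY^{p-i}\in\mathbb{Z}[X,Y]$. For a ring $R$ and an $R$-module $M$, an FW-derivation is a map $D\colon R\to M$ with $D(a+b)=D(a)+D(b)-P(a,b)D(p)$ and $D(ab)=b^pD(a)+a^pD(b)$ for all $a,b\in R$. A log FW-derivation of $(R,Q,\alpha)$ with values in $M$ is a pair $(D,\delta)$ where $D\colon R\to M$ is an FW-derivation and $\delta\colon Q\to M$ is a monoid homomorphism to the additive group of $M$ such that $D(\alpha(x))=\alpha(x)^p\delta(x)$ for every $x\in Q$. The set of these is $F\mathrm{Der}_{(R,Q,\alpha)}(M)$;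 it is an $R$-module under pointwise addition and scalar multiplication of both components, and is functorial in $M$ by composing both components with $R$-linear maps. *)

theory Defs
  imports "HOL-Computational_Algebra.Primes" "HOL-Algebra.AbelCoset" "HOL-Algebra.Module"
begin

section \<open>Prelog rings\<close>

text \<open>The library's \<^const>\<open>hom\<close> only asks for multiplicativity.\<close>

definition monoid_hom ::
    "('a, 'c) monoid_scheme \<Rightarrow> ('b, 'd) monoid_scheme \<Rightarrow> ('a \<Rightarrow> 'b) \<Rightarrow> bool"
  where "monoid_hom G H h \<longleftrightarrow> h \<in> hom G H \<and> h \<one>\<^bsub>G\<^esub> = \<one>\<^bsub>H\<^esub>"

locale prelog_ring = R?: cring R + Q?: comm_monoid Q
  for R (structure) and Q (structure) +
  fixes \<alpha>
  assumes structure_map: "monoid_hom Q R \<alpha>"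

section \<open>Linear maps\<close>

definition module_hom ::
    "('r, 'c) ring_scheme \<Rightarrow> ('r, 'a, 'd) module_scheme \<Rightarrow> ('r, 'b, 'e) module_scheme \<Rightarrow> ('a \<Rightarrow> 'b) set"
  where "module_hom R M N =
    {h \<in> carrier M \<rightarrow> carrier N.
      (\<forall>x\<in>carrier M. \<forall>y\<in>carrier M. h (x \<oplus>\<^bsub>M\<^esub> y) = h x \<oplus>\<^bsub>N\<^esub> h y) \<and>
      (\<forall>r\<in>carrier R. \<forall>x\<in>carrier M. h (r \<odot>\<^bsub>M\<^esub> x) = r \<odot>\<^bsub>N\<^esub> h x)}"

definition module_iso ::
    "('r, 'c) ring_scheme \<Rightarrow> ('r, 'a, 'd) module_scheme \<Rightarrow> ('r, 'b, 'e) module_scheme \<Rightarrow> ('a \<Rightarrow> 'b) set"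
  where "module_iso R M N = {h \<in> module_hom R M N. bij_betw h (carrier M) (carrier N)}"

text \<open>
  The \<open>R\<close>-module of linear maps. Here and below, maps that are elements of a carrier
  are extensional, so that equality in HOL is equality of maps on their domain. The fields
  \<^const>\<open>mult\<close> and \<^const>\<open>one\<close> that the record type of modules inherits from rings play no role.
\<close>

definition Hom_module ::
    "('r, 'c) ring_scheme \<Rightarrow> ('r, 'a, 'd) module_scheme \<Rightarrow> ('r, 'b, 'e) module_scheme \<Rightarrow> ('r, 'a \<Rightarrow> 'b) module"
  where "Hom_module R M N =
    \<lparr>carrier = module_hom R M N \<inter> extensional (carrier M),
     mult = undefined, one = undefined,
     zero = (\<lambda>x\<in>carrier M. \<zero>\<^bsub>N\<^esub>),
     add = (\<lambda>g h. \<lambda>x\<in>carrier M. g x \<oplus>\<^bsub>N\<^esub> h x),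
     smult = (\<lambda>r h. \<lambda>x\<in>carrier M. r \<odot>\<^bsub>N\<^esub> h x)\<rparr>"

section \<open>FW-derivations\<close>

text \<open>
  The coefficients of \<open>P(X,Y)\<close> are integers for prime \<open>p\<close>, so that the truncating
  division in the definition is exact.
\<close>

definition P_coeff :: "nat \<Rightarrow> nat \<Rightarrow> nat"
  where "P_coeff p i = fact (p - 1) div (fact i * fact (p - i))"

lemma P_coeff_exact:
  assumes "prime p" and "i \<in> {1..p - 1}"
  shows "P_coeff p i * (fact i * fact (p - i)) = fact (p - 1)"
proof -
  have i: "0 < i" "i < p" using assms by auto
  have "p dvd p choose i"
    using assms(1) i dvd_choose_prime by simp
  then obtain k where k: "p choose i = p * k" ..
  have "p * (fact i * fact (p - i) * k) = fact i * fact (p - i) * (p choose i)"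
    using k by simp
  also have "\<dots> = fact p"
    using binomial_fact_lemma[of i p] i by simp
  also have "\<dots> = p * fact (p - 1)"
    using i by (simp add: fact_reduce)
  finally have "fact (p - 1) = fact i * fact (p - i) * k"
    using i by simp
  then show ?thesis
    by (metis P_coeff_def dvd_div_mult_self dvd_triv_left)
qed

definition P_eval :: "nat \<Rightarrow> ('r, 'c) ring_scheme \<Rightarrow> 'r \<Rightarrow> 'r \<Rightarrow> 'r"
  where "P_eval p R a b =
    (\<Oplus>\<^bsub>R\<^esub>i\<in>{1..p - 1}. [P_coeff p i] \<cdot>\<^bsub>R\<^esub> (a [^]\<^bsub>R\<^esub> i \<otimes>\<^bsub>R\<^esub> b [^]\<^bsub>R\<^esub> (p - i)))"

definition FW_derivation ::
    "nat \<Rightarrow> ('r, 'c) ring_scheme \<Rightarrow> ('r, 'm, 'd) module_scheme \<Rightarrow> ('r \<Rightarrow> 'm) \<Rightarrow> bool"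
  where "FW_derivation p R M D \<longleftrightarrow>
    D \<in> carrier R \<rightarrow> carrier M \<and>
    (\<forall>a\<in>carrier R. \<forall>b\<in>carrier R.
      D (a \<oplus>\<^bsub>R\<^esub> b) = D a \<oplus>\<^bsub>M\<^esub> D b \<ominus>\<^bsub>M\<^esub> P_eval p R a b \<odot>\<^bsub>M\<^esub> D ([p] \<cdot>\<^bsub>R\<^esub> \<one>\<^bsub>R\<^esub>)) \<and>
    (\<forall>a\<in>carrier R. \<forall>b\<in>carrier R.
      D (a \<otimes>\<^bsub>R\<^esub> b) = (b [^]\<^bsub>R\<^esub> p) \<odot>\<^bsub>M\<^esub> D a \<oplus>\<^bsub>M\<^esub> (a [^]\<^bsub>R\<^esub> p) \<odot>\<^bsub>M\<^esub> D b)"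

definition log_FW_derivation ::
    "nat \<Rightarrow> ('r, 'c) ring_scheme \<Rightarrow> ('q, 'e) monoid_scheme \<Rightarrow> ('q \<Rightarrow> 'r) \<Rightarrow>
     ('r, 'm, 'd) module_scheme \<Rightarrow> ('r \<Rightarrow> 'm) \<times> ('q \<Rightarrow> 'm) \<Rightarrow> bool"
  where "log_FW_derivation p R Q \<alpha> M = (\<lambda>(D, \<delta>).
    FW_derivation p R M D \<and>
    monoid_hom Q (add_monoid M) \<delta> \<and>
    (\<forall>x\<in>carrier Q. D (\<alpha> x) = (\<alpha> x [^]\<^bsub>R\<^esub> p) \<odot>\<^bsub>M\<^esub> \<delta> x))"

definition FDer ::
    "nat \<Rightarrow> ('r, 'c) ring_scheme \<Rightarrow> ('q, 'e) monoid_scheme \<Rightarrow> ('q \<Rightarrow> 'r) \<Rightarrow>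
     ('r, 'm, 'd) module_scheme \<Rightarrow> ('r, ('r \<Rightarrow> 'm) \<times> ('q \<Rightarrow> 'm)) module"
  where "FDer p R Q \<alpha> M =
    \<lparr>carrier = {d \<in> extensional (carrier R) \<times> extensional (carrier Q). log_FW_derivation p R Q \<alpha> M d},
     mult = undefined, one = undefined,
     zero = (\<lambda>a\<in>carrier R. \<zero>\<^bsub>M\<^esub>, \<lambda>x\<in>carrier Q. \<zero>\<^bsub>M\<^esub>),
     add = (\<lambda>(D, \<delta>) (D', \<delta>').
       (\<lambda>a\<in>carrier R. D a \<oplus>\<^bsub>M\<^esub> D' a, \<lambda>x\<in>carrier Q. \<delta> x \<oplus>\<^bsub>M\<^esub> \<delta>' x)),
     smult = (\<lambda>r (D, \<delta>).
       (\<lambda>a\<in>carrier R. r \<odot>\<^bsub>M\<^esub> D a, \<lambda>x\<in>carrier Q. r \<odot>\<^bsub>M\<^esub> \<delta> x))\<rparr>"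

text \<open>The action \<open>(D, \<delta>) \<mapsto> (u \<circ> D, u \<circ> \<delta>)\<close> of a linear map \<open>u\<close>.\<close>

definition FDer_map ::
    "('r, 'c) ring_scheme \<Rightarrow> ('q, 'e) monoid_scheme \<Rightarrow> ('m \<Rightarrow> 'n) \<Rightarrow>
     ('r \<Rightarrow> 'm) \<times> ('q \<Rightarrow> 'm) \<Rightarrow> ('r \<Rightarrow> 'n) \<times> ('q \<Rightarrow> 'n)"
  where "FDer_map R Q u = (\<lambda>(D, \<delta>). (compose (carrier R) u D, compose (carrier Q) u \<delta>))"

section \<open>Free modules, spans and quotients\<close>

definition free_module :: "('r, 'c) ring_scheme \<Rightarrow> 'x set \<Rightarrow> ('r, 'x \<Rightarrow> 'r) module"
  where "free_module R X =
    \<lparr>carrier = {f \<in> X \<rightarrow>\<^sub>E carrier R. finite {x \<in> X. f x \<noteq> \<zero>\<^bsub>R\<^esub>}},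
     mult = undefined, one = undefined,
     zero = (\<lambda>x\<in>X. \<zero>\<^bsub>R\<^esub>),
     add = (\<lambda>f g. \<lambda>x\<in>X. f x \<oplus>\<^bsub>R\<^esub> g x),
     smult = (\<lambda>r f. \<lambda>x\<in>X. r \<otimes>\<^bsub>R\<^esub> f x)\<rparr>"

definition free_gen :: "('r, 'c) ring_scheme \<Rightarrow> 'x set \<Rightarrow> 'x \<Rightarrow> 'x \<Rightarrow> 'r"
  where "free_gen R X x = (\<lambda>y\<in>X. if y = x then \<one>\<^bsub>R\<^esub> else \<zero>\<^bsub>R\<^esub>)"

definition submodule_span :: "('r, 'c) ring_scheme \<Rightarrow> ('r, 'm, 'd) module_scheme \<Rightarrow> 'm set \<Rightarrow> 'm set"
  where "submodule_span R M S = \<Inter>{H. submodule H R M \<and> S \<subseteq> H}"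

text \<open>The union in the scalar multiplication is over representatives; all of them give the same coset.\<close>

definition quotient_module :: "('r, 'm, 'd) module_scheme \<Rightarrow> 'm set \<Rightarrow> ('r, 'm set) module"
  where "quotient_module M N =
    \<lparr>carrier = a_rcosets\<^bsub>M\<^esub> N,
     mult = undefined, one = undefined,
     zero = N,
     add = (\<lambda>C C'. C <+>\<^bsub>M\<^esub> C'),
     smult = (\<lambda>r C. \<Union>c\<in>C. N +>\<^bsub>M\<^esub> (r \<odot>\<^bsub>M\<^esub> c))\<rparr>"

section \<open>The module of log FW-differentials\<close>

text \<open>
  A quantifier over modules of all types cannot occur below an existential quantifier in HOL.
  The representing object is therefore given by generators and relations: it is the quotient
  of the free module on symbols \<open>w a\<close> (\<open>a \<in> R\<close>) and \<open>wlog x\<close> (\<open>x \<in> Q\<close>) by the relations that make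
  \<open>(w, wlog)\<close> a log FW-derivation. In this form the universal property can be stated for
  modules of arbitrary type.
\<close>

definition FOmega_gens :: "('r, 'c) ring_scheme \<Rightarrow> ('q, 'e) monoid_scheme \<Rightarrow> ('r + 'q) set"
  where "FOmega_gens R Q = Inl ` carrier R \<union> Inr ` carrier Q"

definition FOmega_free ::
    "('r, 'c) ring_scheme \<Rightarrow> ('q, 'e) monoid_scheme \<Rightarrow> ('r, 'r + 'q \<Rightarrow> 'r) module"
  where "FOmega_free R Q = free_module R (FOmega_gens R Q)"

definition FOmega_rels ::
    "nat \<Rightarrow> ('r, 'c) ring_scheme \<Rightarrow> ('q, 'e) monoid_scheme \<Rightarrow> ('q \<Rightarrow> 'r) \<Rightarrow> ('r + 'q \<Rightarrow> 'r) set"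
  where "FOmega_rels p R Q \<alpha> =
    (let F = FOmega_free R Q;
         d = (\<lambda>a. free_gen R (FOmega_gens R Q) (Inl a));
         l = (\<lambda>x. free_gen R (FOmega_gens R Q) (Inr x))
     in {d (a \<oplus>\<^bsub>R\<^esub> b) \<ominus>\<^bsub>F\<^esub> (d a \<oplus>\<^bsub>F\<^esub> d b \<ominus>\<^bsub>F\<^esub> P_eval p R a b \<odot>\<^bsub>F\<^esub> d ([p] \<cdot>\<^bsub>R\<^esub> \<one>\<^bsub>R\<^esub>)) | a b.
           a \<in> carrier R \<and> b \<in> carrier R}
      \<union> {d (a \<otimes>\<^bsub>R\<^esub> b) \<ominus>\<^bsub>F\<^esub> ((b [^]\<^bsub>R\<^esub> p) \<odot>\<^bsub>F\<^esub> d a \<oplus>\<^bsub>F\<^esub> (a [^]\<^bsub>R\<^esub> p) \<odot>\<^bsub>F\<^esub> d b) | a b.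
           a \<in> carrier R \<and> b \<in> carrier R}
      \<union> {l (x \<otimes>\<^bsub>Q\<^esub> y) \<ominus>\<^bsub>F\<^esub> (l x \<oplus>\<^bsub>F\<^esub> l y) | x y. x \<in> carrier Q \<and> y \<in> carrier Q}
      \<union> {l \<one>\<^bsub>Q\<^esub>}
      \<union> {d (\<alpha> x) \<ominus>\<^bsub>F\<^esub> (\<alpha> x [^]\<^bsub>R\<^esub> p) \<odot>\<^bsub>F\<^esub> l x | x. x \<in> carrier Q})"

definition FOmega_ker ::
    "nat \<Rightarrow> ('r, 'c) ring_scheme \<Rightarrow> ('q, 'e) monoid_scheme \<Rightarrow> ('q \<Rightarrow> 'r) \<Rightarrow> ('r + 'q \<Rightarrow> 'r) set"
  where "FOmega_ker p R Q \<alpha> = submodule_span R (FOmega_free R Q) (FOmega_rels p R Q \<alpha>)"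

definition FOmega ::
    "nat \<Rightarrow> ('r, 'c) ring_scheme \<Rightarrow> ('q, 'e) monoid_scheme \<Rightarrow> ('q \<Rightarrow> 'r) \<Rightarrow>
     ('r, ('r + 'q \<Rightarrow> 'r) set) module"
  where "FOmega p R Q \<alpha> = quotient_module (FOmega_free R Q) (FOmega_ker p R Q \<alpha>)"

definition univ_w ::
    "nat \<Rightarrow> ('r, 'c) ring_scheme \<Rightarrow> ('q, 'e) monoid_scheme \<Rightarrow> ('q \<Rightarrow> 'r) \<Rightarrow>
     'r \<Rightarrow> ('r + 'q \<Rightarrow> 'r) set"
  where "univ_w p R Q \<alpha> = (\<lambda>a\<in>carrier R.
    FOmega_ker p R Q \<alpha> +>\<^bsub>FOmega_free R Q\<^esub> free_gen R (FOmega_gens R Q) (Inl a))"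

definition univ_wlog ::
    "nat \<Rightarrow> ('r, 'c) ring_scheme \<Rightarrow> ('q, 'e) monoid_scheme \<Rightarrow> ('q \<Rightarrow> 'r) \<Rightarrow>
     'q \<Rightarrow> ('r + 'q \<Rightarrow> 'r) set"
  where "univ_wlog p R Q \<alpha> = (\<lambda>x\<in>carrier Q.
    FOmega_ker p R Q \<alpha> +>\<^bsub>FOmega_free R Q\<^esub> free_gen R (FOmega_gens R Q) (Inr x))"

text \<open>The map \<open>Hom(F\<Omega>, M) \<rightarrow> FDer(M)\<close>, \<open>u \<mapsto> (u \<circ> w, u \<circ> wlog)\<close>.\<close>

definition univ_map ::
    "nat \<Rightarrow> ('r, 'c) ring_scheme \<Rightarrow> ('q, 'e) monoid_scheme \<Rightarrow> ('q \<Rightarrow> 'r) \<Rightarrow>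
     (('r + 'q \<Rightarrow> 'r) set \<Rightarrow> 'm) \<Rightarrow> ('r \<Rightarrow> 'm) \<times> ('q \<Rightarrow> 'm)"
  where "univ_map p R Q \<alpha> u = FDer_map R Q u (univ_w p R Q \<alpha>, univ_wlog p R Q \<alpha>)"

end

theory Submission
  imports Defs
begin

text \<open>
  The functor \<open>M \<mapsto> FDer(M)\<close> is representable because a log FW-derivation is nothing but a family of
  elements of \<open>M\<close>, indexed by the disjoint union of \<open>R\<close> and \<open>Q\<close>, that satisfies linear equations
  with coefficients in \<open>R\<close>. Families of elements are linear maps out of a free module \<open>F\<close>, and
  families satisfying linear equations are linear maps out of the quotient of \<open>F\<close> by the submodule
  \<open>K\<close> that the equations generate.

  Two ingredients are independent of derivations: the universal property of the free module, which
  is \<open>free_ext_hom\<close> with \<open>free_ext_gen\<close> for existence and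
  \<open>free_module_generated\<close> for uniqueness; and the universal property of the quotient,
  \<open>quotient_factor\<close>. The link with derivations is \<open>kills_rels_iff\<close>: for a linear map
  \<open>h\<close> from \<open>F\<close> to \<open>M\<close>, the pair of families \<open>h\<close> takes on the generators is a log FW-derivation if
  and only if \<open>h\<close> vanishes on every relation. It serves both directions.
  Applied to the projection from \<open>F\<close> to \<open>F/K\<close>, composed with a linear map \<open>u\<close>, it shows that
  \<open>(u \<circ> w, u \<circ> wlog)\<close> is a log FW-derivation; applied to the linear extension of a given pair
  \<open>(D, \<delta>)\<close>, it shows that this extension vanishes on \<open>K\<close> and so descends to \<open>F/K\<close>.
\<close>

section \<open>Linear maps\<close>

lemma module_homI:
  assumes "\<And>x. x \<in> carrier M \<Longrightarrow> h x \<in> carrier N"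
    and "\<And>x y. x \<in> carrier M \<Longrightarrow> y \<in> carrier M \<Longrightarrow> h (x \<oplus>\<^bsub>M\<^esub> y) = h x \<oplus>\<^bsub>N\<^esub> h y"
    and "\<And>r x. r \<in> carrier R \<Longrightarrow> x \<in> carrier M \<Longrightarrow> h (r \<odot>\<^bsub>M\<^esub> x) = r \<odot>\<^bsub>N\<^esub> h x"
  shows "h \<in> module_hom R M N"
  using assms by (auto simp: module_hom_def)

lemma module_homD:
  assumes "h \<in> module_hom R M N"
  shows module_hom_closed: "x \<in> carrier M \<Longrightarrow> h x \<in> carrier N"
    and module_hom_add: "x \<in> carrier M \<Longrightarrow> y \<in> carrier M \<Longrightarrow> h (x \<oplus>\<^bsub>M\<^esub> y) = h x \<oplus>\<^bsub>N\<^esub> h y"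
    and module_hom_smult: "r \<in> carrier R \<Longrightarrow> x \<in> carrier M \<Longrightarrow> h (r \<odot>\<^bsub>M\<^esub> x) = r \<odot>\<^bsub>N\<^esub> h x"
  using assms by (auto simp: module_hom_def)

lemma module_hom_comp:
  assumes "h \<in> module_hom R L M" and "g \<in> module_hom R M N"
  shows "(\<lambda>x. g (h x)) \<in> module_hom R L N"
  using assms by (auto simp: module_hom_def Pi_iff)

lemma module_hom_zero:
  assumes "module R M" and "module R N" and h: "h \<in> module_hom R M N"
  shows "h \<zero>\<^bsub>M\<^esub> = \<zero>\<^bsub>N\<^esub>"
proof -
  interpret M: module R M by fact
  interpret N: module R N by fact
  have "h (\<zero>\<^bsub>R\<^esub> \<odot>\<^bsub>M\<^esub> \<zero>\<^bsub>M\<^esub>) = \<zero>\<^bsub>R\<^esub> \<odot>\<^bsub>N\<^esub> h \<zero>\<^bsub>M\<^esub>"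
    by (simp add: module_hom_smult[OF h] del: M.smult_l_null M.smult_r_null)
  then show ?thesis
    by (simp add: module_hom_closed[OF h])
qed

lemma module_hom_a_inv:
  assumes "module R M" and "module R N" and h: "h \<in> module_hom R M N" and x: "x \<in> carrier M"
  shows "h (\<ominus>\<^bsub>M\<^esub> x) = \<ominus>\<^bsub>N\<^esub> h x"
proof -
  interpret M: module R M by fact
  interpret N: module R N by fact
  have "h ((\<ominus>\<^bsub>R\<^esub> \<one>\<^bsub>R\<^esub>) \<odot>\<^bsub>M\<^esub> x) = (\<ominus>\<^bsub>R\<^esub> \<one>\<^bsub>R\<^esub>) \<odot>\<^bsub>N\<^esub> h x"
    using x by (simp add: module_hom_smult[OF h] del: M.smult_l_minus N.smult_l_minus)
  then show ?thesis
    using x by (simp add: module_hom_closed[OF h] M.smult_l_minus N.smult_l_minus)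
qed

lemma module_hom_minus:
  assumes "module R M" and "module R N" and h: "h \<in> module_hom R M N"
    and x: "x \<in> carrier M" "y \<in> carrier M"
  shows "h (x \<ominus>\<^bsub>M\<^esub> y) = h x \<ominus>\<^bsub>N\<^esub> h y"
proof -
  interpret M: module R M by fact
  show ?thesis
    using x by (simp add: a_minus_def module_hom_add[OF h] module_hom_a_inv[OF assms(1-3)])
qed

lemma (in abelian_group) minus_eq_zero_iff:
  assumes "x \<in> carrier G" and "y \<in> carrier G"
  shows "x \<ominus> y = \<zero> \<longleftrightarrow> x = y"
  using assms by (metis a_minus_def add.inv_solve_right' add.l_one zero_closed)

text \<open>
  This carries two kinds of argument about generators: a linear map that vanishes on generators
  vanishes (take \<open>g\<close> to be zero), and two linear maps that agree on generators agree.
\<close>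

lemma equalizer_submodule:
  assumes "module R M" and "module R N"
    and h: "h \<in> module_hom R M N" and g: "g \<in> module_hom R M N"
  shows "submodule {x \<in> carrier M. h x = g x} R M"
proof -
  interpret M: module R M by fact
  show ?thesis
    by (rule M.submoduleI)
      (auto simp: module_hom_add[OF h] module_hom_add[OF g] module_hom_smult[OF h] module_hom_smult[OF g]
        module_hom_zero[OF assms(1,2) h] module_hom_zero[OF assms(1,2) g]
        module_hom_a_inv[OF assms(1,2) h] module_hom_a_inv[OF assms(1,2) g])
qed

lemma zero_module_hom:
  assumes "module R N"
  shows "(\<lambda>_. \<zero>\<^bsub>N\<^esub>) \<in> module_hom R M N"
proof -
  interpret N: module R N by fact
  show ?thesis by (rule module_homI) auto
qed

section \<open>Spans\<close>

lemma submodule_span_superset: "S \<subseteq> submodule_span R M S"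
  by (auto simp: submodule_span_def)

lemma submodule_span_minimal:
  assumes "submodule H R M" and "S \<subseteq> H"
  shows "submodule_span R M S \<subseteq> H"
  using assms by (auto simp: submodule_span_def)

lemma submodule_span_submodule:
  assumes "module R M" and S: "S \<subseteq> carrier M"
  shows "submodule (submodule_span R M S) R M"
proof -
  interpret M: module R M by fact
  show ?thesis
  proof (rule M.submoduleI)
    show "submodule_span R M S \<subseteq> carrier M"
      using submodule_span_minimal[OF M.carrier_is_submodule S] .
    show "\<zero>\<^bsub>M\<^esub> \<in> submodule_span R M S"
      using subgroup.one_closed[OF submodule.axioms(1)] by (fastforce simp: submodule_span_def)
  qed (auto simp: submodule_span_def M.submoduleE)
qed

lemma hom_zero_on_span:
  assumes "module R M" and "module R N" and h: "h \<in> module_hom R M N"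
    and "S \<subseteq> carrier M" and "\<forall>s\<in>S. h s = \<zero>\<^bsub>N\<^esub>" and "x \<in> submodule_span R M S"
  shows "h x = \<zero>\<^bsub>N\<^esub>"
proof -
  have "submodule {x \<in> carrier M. h x = \<zero>\<^bsub>N\<^esub>} R M"
    using equalizer_submodule[OF assms(1-2) h zero_module_hom[OF assms(2)]] .
  then have "submodule_span R M S \<subseteq> {x \<in> carrier M. h x = \<zero>\<^bsub>N\<^esub>}"
    by (rule submodule_span_minimal) (use assms in auto)
  then show ?thesis using assms(6) by auto
qed

section \<open>Free modules\<close>

lemma free_module_simps:
  "f \<in> carrier (free_module R X) \<longleftrightarrow> f \<in> X \<rightarrow>\<^sub>E carrier R \<and> finite {x \<in> X. f x \<noteq> \<zero>\<^bsub>R\<^esub>}"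
  "\<zero>\<^bsub>free_module R X\<^esub> = (\<lambda>x\<in>X. \<zero>\<^bsub>R\<^esub>)"
  "f \<oplus>\<^bsub>free_module R X\<^esub> g = (\<lambda>x\<in>X. f x \<oplus>\<^bsub>R\<^esub> g x)"
  "r \<odot>\<^bsub>free_module R X\<^esub> f = (\<lambda>x\<in>X. r \<otimes>\<^bsub>R\<^esub> f x)"
  by (auto simp: free_module_def)

lemma free_module_closed:
  assumes "cring R"
  shows free_module_zero: "\<zero>\<^bsub>free_module R X\<^esub> \<in> carrier (free_module R X)"
    and free_module_add: "f \<in> carrier (free_module R X) \<Longrightarrow> g \<in> carrier (free_module R X) \<Longrightarrow>
      f \<oplus>\<^bsub>free_module R X\<^esub> g \<in> carrier (free_module R X)"
    and free_module_smult: "r \<in> carrier R \<Longrightarrow> f \<in> carrier (free_module R X) \<Longrightarrow>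
      r \<odot>\<^bsub>free_module R X\<^esub> f \<in> carrier (free_module R X)"
proof -
  interpret cring R by fact
  show "\<zero>\<^bsub>free_module R X\<^esub> \<in> carrier (free_module R X)"
    by (auto simp: free_module_simps)
  show "f \<oplus>\<^bsub>free_module R X\<^esub> g \<in> carrier (free_module R X)"
    if f: "f \<in> carrier (free_module R X)" and g: "g \<in> carrier (free_module R X)"
  proof -
    have "finite ({x \<in> X. f x \<noteq> \<zero>\<^bsub>R\<^esub>} \<union> {x \<in> X. g x \<noteq> \<zero>\<^bsub>R\<^esub>})"
      using f g by (simp add: free_module_simps)
    then have "finite {x \<in> X. f x \<oplus>\<^bsub>R\<^esub> g x \<noteq> \<zero>\<^bsub>R\<^esub>}"
      by (rule rev_finite_subset) auto
    then show ?thesis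
      using f g by (auto simp: free_module_simps PiE_iff cong: conj_cong)
  qed
  show "r \<odot>\<^bsub>free_module R X\<^esub> f \<in> carrier (free_module R X)"
    if r: "r \<in> carrier R" and f: "f \<in> carrier (free_module R X)"
  proof -
    have "finite {x \<in> X. f x \<noteq> \<zero>\<^bsub>R\<^esub>}"
      using f by (simp add: free_module_simps)
    then have "finite {x \<in> X. r \<otimes>\<^bsub>R\<^esub> f x \<noteq> \<zero>\<^bsub>R\<^esub>}"
      by (rule rev_finite_subset) (use r in auto)
    then show ?thesis
      using r f by (auto simp: free_module_simps PiE_iff cong: conj_cong)
  qed
qed

lemma free_module_module:
  assumes "cring R"
  shows "module R (free_module R X)"
proof -
  interpret cring R by fact
  let ?F = "free_module R X"
  have val: "f x \<in> carrier R" if "f \<in> carrier ?F" "x \<in> X" for f x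
    using that by (auto simp: free_module_simps)
  have ext: "(\<lambda>x\<in>X. f x) = f" if "f \<in> carrier ?F" for f
    using that by (auto simp: free_module_simps PiE_restrict)
  show ?thesis
  proof (rule moduleI[OF assms])
    show "abelian_group ?F"
    proof (rule abelian_groupI)
      show "\<exists>g\<in>carrier ?F. g \<oplus>\<^bsub>?F\<^esub> f = \<zero>\<^bsub>?F\<^esub>" if f: "f \<in> carrier ?F" for f
      proof
        show "(\<ominus>\<^bsub>R\<^esub> \<one>\<^bsub>R\<^esub>) \<odot>\<^bsub>?F\<^esub> f \<in> carrier ?F"
          using f by (simp add: free_module_smult[OF assms])
        show "(\<ominus>\<^bsub>R\<^esub> \<one>\<^bsub>R\<^esub>) \<odot>\<^bsub>?F\<^esub> f \<oplus>\<^bsub>?F\<^esub> f = \<zero>\<^bsub>?F\<^esub>"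
          using val[OF f] by (auto simp: free_module_simps(2-) l_minus l_neg intro!: restrict_ext)
      qed
    qed (use free_module_zero[OF assms] free_module_add[OF assms] in
        \<open>auto intro!: restrict_ext simp: free_module_simps(2-) val a_ac ext cong: restrict_cong\<close>)
  qed (use free_module_smult[OF assms] in
      \<open>auto intro!: restrict_ext simp: free_module_simps(2-) val l_distr r_distr m_assoc ext
        cong: restrict_cong\<close>)
qed

lemma free_gen_closed:
  assumes "cring R"
  shows "free_gen R X x \<in> carrier (free_module R X)"
proof -
  interpret cring R by fact
  have "finite {y \<in> X. free_gen R X x y \<noteq> \<zero>\<^bsub>R\<^esub>}"
    by (rule finite_subset[of _ "{x}"]) (auto simp: free_gen_def)
  then show ?thesis
    by (auto simp: free_module_simps free_gen_def)
qed

text \<open>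
  The values of \<open>f\<close> can be cleared one by one: subtracting \<open>f x\<close> times the generator \<open>x\<close> removes \<open>x\<close>
  from the support, so the claim follows by induction on a finite set containing the support.
\<close>

lemma free_module_generated:
  assumes "cring R" and H: "submodule H R (free_module R X)"
    and gen: "\<forall>x\<in>X. free_gen R X x \<in> H"
  shows "carrier (free_module R X) \<subseteq> H"
proof
  interpret cring R by fact
  let ?F = "free_module R X"
  interpret F: module R ?F by (rule free_module_module) fact
  have "\<forall>f\<in>carrier ?F. {x \<in> X. f x \<noteq> \<zero>\<^bsub>R\<^esub>} \<subseteq> A \<longrightarrow> f \<in> H" if "finite A" for A
    using that
  proof induction
    case empty
    have "f = \<zero>\<^bsub>?F\<^esub>" if "f \<in> carrier ?F" "{x \<in> X. f x \<noteq> \<zero>\<^bsub>R\<^esub>} \<subseteq> {}" for f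
      using that by (auto simp: free_module_simps fun_eq_iff PiE_iff extensional_def)
    then show ?case
      using subgroup.one_closed[OF submodule.axioms(1)[OF H]] by auto
  next
    case (insert x A)
    show ?case
    proof (intro ballI impI)
      fix f
      assume f: "f \<in> carrier ?F" and supp: "{y \<in> X. f y \<noteq> \<zero>\<^bsub>R\<^esub>} \<subseteq> insert x A"
      show "f \<in> H"
      proof (cases "x \<in> X")
        case False
        then show ?thesis using insert.IH f supp by auto
      next
        case True
        define g where "g = f(x := \<zero>\<^bsub>R\<^esub>)"
        have "finite {y \<in> X. f y \<noteq> \<zero>\<^bsub>R\<^esub>}"
          using f by (simp add: free_module_simps)
        then have "finite {y \<in> X. g y \<noteq> \<zero>\<^bsub>R\<^esub>}"
          by (rule rev_finite_subset) (auto simp: g_def)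
        then have g: "g \<in> carrier ?F"
          using f True by (auto simp: free_module_simps g_def PiE_iff extensional_def)
        have "{y \<in> X. g y \<noteq> \<zero>\<^bsub>R\<^esub>} \<subseteq> A"
          using supp by (auto simp: g_def)
        then have gH: "g \<in> H" using insert.IH g by auto
        have fx: "f x \<in> carrier R" using f True by (auto simp: free_module_simps)
        have "f = g \<oplus>\<^bsub>?F\<^esub> f x \<odot>\<^bsub>?F\<^esub> free_gen R X x"
        proof
          fix y
          show "f y = (g \<oplus>\<^bsub>?F\<^esub> f x \<odot>\<^bsub>?F\<^esub> free_gen R X x) y"
            using f fx True
            by (cases "y \<in> X") (auto simp: free_module_simps g_def free_gen_def PiE_iff extensional_def)
        qed
        moreover have "g \<oplus>\<^bsub>?F\<^esub> f x \<odot>\<^bsub>?F\<^esub> free_gen R X x \<in> H"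
          using F.submoduleE(4,5)[OF H] gH fx gen True by auto
        ultimately show ?thesis by simp
      qed
    qed
  qed
  then show "f \<in> H" if "f \<in> carrier ?F" for f
    using that by (auto simp: free_module_simps)
qed

definition free_ext ::
    "('r, 'c) ring_scheme \<Rightarrow> ('r, 'm, 'd) module_scheme \<Rightarrow> 'x set \<Rightarrow> ('x \<Rightarrow> 'm) \<Rightarrow> ('x \<Rightarrow> 'r) \<Rightarrow> 'm"
  where "free_ext R M X \<phi> f = (\<Oplus>\<^bsub>M\<^esub>x\<in>{x \<in> X. f x \<noteq> \<zero>\<^bsub>R\<^esub>}. f x \<odot>\<^bsub>M\<^esub> \<phi> x)"

text \<open>
  The supports of \<open>f\<close>, \<open>g\<close> and \<open>f + g\<close> differ; summing over a common finite set that contains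
  all three makes the linearity of \<open>free_ext\<close> the linearity of a finite sum.
\<close>

lemma free_ext_eq:
  assumes "module R M" and "\<phi> \<in> X \<rightarrow> carrier M" and f: "f \<in> carrier (free_module R X)"
    and A: "finite A" "{x \<in> X. f x \<noteq> \<zero>\<^bsub>R\<^esub>} \<subseteq> A" "A \<subseteq> X"
  shows "free_ext R M X \<phi> f = (\<Oplus>\<^bsub>M\<^esub>x\<in>A. f x \<odot>\<^bsub>M\<^esub> \<phi> x)"
proof -
  interpret M: module R M by fact
  show ?thesis
    unfolding free_ext_def
    by (rule M.add.finprod_mono_neutral_cong_left)
      (use assms in \<open>auto simp: free_module_simps Pi_iff PiE_iff subset_iff\<close>)
qed

lemma free_ext_hom:
  assumes "module R M" and \<phi>: "\<phi> \<in> X \<rightarrow> carrier M"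
  shows "free_ext R M X \<phi> \<in> module_hom R (free_module R X) M"
proof -
  interpret M: module R M by fact
  let ?F = "free_module R X"
  let ?S = "\<lambda>f. {x \<in> X. f x \<noteq> \<zero>\<^bsub>R\<^esub>}"
  have R: "cring R" ..
  have val: "f x \<in> carrier R" if "f \<in> carrier ?F" "x \<in> X" for f x
    using that by (auto simp: free_module_simps)
  have fin: "finite (?S f)" if "f \<in> carrier ?F" for f
    using that by (auto simp: free_module_simps)
  have \<phi>x: "\<phi> x \<in> carrier M" if "x \<in> X" for x using \<phi> that by auto
  show ?thesis
  proof (rule module_homI)
    fix f assume f: "f \<in> carrier ?F"
    show "free_ext R M X \<phi> f \<in> carrier M"
      unfolding free_ext_def by (rule M.finsum_closed) (auto simp: val[OF f] \<phi>x)
    fix g assume g: "g \<in> carrier ?F"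
    let ?A = "?S f \<union> ?S g"
    have A: "finite ?A" "?A \<subseteq> X" using fin f g by auto
    have "free_ext R M X \<phi> (f \<oplus>\<^bsub>?F\<^esub> g) = (\<Oplus>\<^bsub>M\<^esub>x\<in>?A. (f \<oplus>\<^bsub>?F\<^esub> g) x \<odot>\<^bsub>M\<^esub> \<phi> x)"
      by (rule free_ext_eq[OF assms free_module_add[OF R f g] A(1) _ A(2)])
        (auto simp: free_module_simps)
    also have "\<dots> = (\<Oplus>\<^bsub>M\<^esub>x\<in>?A. f x \<odot>\<^bsub>M\<^esub> \<phi> x \<oplus>\<^bsub>M\<^esub> g x \<odot>\<^bsub>M\<^esub> \<phi> x)"
      by (rule M.finsum_cong')
        (auto simp: free_module_simps val[OF f] val[OF g] \<phi>x M.smult_l_distr)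
    also have "\<dots> = (\<Oplus>\<^bsub>M\<^esub>x\<in>?A. f x \<odot>\<^bsub>M\<^esub> \<phi> x) \<oplus>\<^bsub>M\<^esub> (\<Oplus>\<^bsub>M\<^esub>x\<in>?A. g x \<odot>\<^bsub>M\<^esub> \<phi> x)"
      by (rule M.finsum_addf) (auto simp: val[OF f] val[OF g] \<phi>x)
    also have "\<dots> = free_ext R M X \<phi> f \<oplus>\<^bsub>M\<^esub> free_ext R M X \<phi> g"
      using free_ext_eq[OF assms f A(1) _ A(2)] free_ext_eq[OF assms g A(1) _ A(2)] by simp
    finally show "free_ext R M X \<phi> (f \<oplus>\<^bsub>?F\<^esub> g) = free_ext R M X \<phi> f \<oplus>\<^bsub>M\<^esub> free_ext R M X \<phi> g" .
  next
    fix r f assume r: "r \<in> carrier R" and f: "f \<in> carrier ?F"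
    have "free_ext R M X \<phi> (r \<odot>\<^bsub>?F\<^esub> f) = (\<Oplus>\<^bsub>M\<^esub>x\<in>?S f. (r \<odot>\<^bsub>?F\<^esub> f) x \<odot>\<^bsub>M\<^esub> \<phi> x)"
      by (rule free_ext_eq[OF assms free_module_smult[OF R r f] fin[OF f]])
        (auto simp: free_module_simps r)
    also have "\<dots> = (\<Oplus>\<^bsub>M\<^esub>x\<in>?S f. r \<odot>\<^bsub>M\<^esub> (f x \<odot>\<^bsub>M\<^esub> \<phi> x))"
      by (rule M.finsum_cong') (auto simp: free_module_simps val[OF f] r \<phi>x M.smult_assoc1)
    also have "\<dots> = r \<odot>\<^bsub>M\<^esub> free_ext R M X \<phi> f"
      unfolding free_ext_def
      by (rule M.finsum_smult_ldistr[symmetric]) (auto simp: fin[OF f] r val[OF f] \<phi>x)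
    finally show "free_ext R M X \<phi> (r \<odot>\<^bsub>?F\<^esub> f) = r \<odot>\<^bsub>M\<^esub> free_ext R M X \<phi> f" .
  qed
qed

lemma free_ext_gen:
  assumes "module R M" and \<phi>: "\<phi> \<in> X \<rightarrow> carrier M" and x: "x \<in> X"
  shows "free_ext R M X \<phi> (free_gen R X x) = \<phi> x"
proof -
  interpret M: module R M by fact
  have R: "cring R" ..
  have \<phi>x: "\<phi> x \<in> carrier M" using \<phi> x by auto
  have "free_ext R M X \<phi> (free_gen R X x) = (\<Oplus>\<^bsub>M\<^esub>y\<in>{x}. free_gen R X x y \<odot>\<^bsub>M\<^esub> \<phi> y)"
    by (rule free_ext_eq[OF assms(1,2) free_gen_closed[OF R]]) (use x in \<open>auto simp: free_gen_def\<close>)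
  also have "\<dots> = \<phi> x"
    using x \<phi>x by (simp add: free_gen_def Pi_def)
  finally show ?thesis .
qed

section \<open>Quotient modules\<close>

locale module_quotient = module R M + submodule N R M for N and R (structure) and M (structure)
begin

sublocale abelian_subgroup N M
  by (intro abelian_subgroupI3 additive_subgroup.intro M.abelian_group_axioms subgroup_axioms)

abbreviation proj where "proj x \<equiv> N +>\<^bsub>M\<^esub> x"

lemma carrier_quotient: "carrier (quotient_module M N) = proj ` carrier M"
  by (auto simp: quotient_module_def A_RCOSETS_def')

lemma proj_eq_iff:
  assumes "x \<in> carrier M" and "y \<in> carrier M"
  shows "proj x = proj y \<longleftrightarrow> x \<ominus>\<^bsub>M\<^esub> y \<in> N"
  using a_rcos_module[of y x] a_repr_independence'[of x y] a_repr_independenceD[of x y] assms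
  unfolding a_minus_def by metis

lemma add_quotient:
  assumes "x \<in> carrier M" and "y \<in> carrier M"
  shows "proj x \<oplus>\<^bsub>quotient_module M N\<^esub> proj y = proj (x \<oplus>\<^bsub>M\<^esub> y)"
  using a_rcos_sum[OF assms] by (simp add: quotient_module_def)

lemma zero_quotient: "\<zero>\<^bsub>quotient_module M N\<^esub> = proj \<zero>\<^bsub>M\<^esub>"
  using a_subset by (simp add: quotient_module_def)

text \<open>
  The scalar multiplication of the quotient is a union over representatives. All its members
  coincide, because \<open>N\<close> is closed under scalars: if \<open>c - x\<close> lies in \<open>N\<close>, so does \<open>r c - r x\<close>.
\<close>

lemma smult_quotient:
  assumes r: "r \<in> carrier R" and x: "x \<in> carrier M"
  shows "r \<odot>\<^bsub>quotient_module M N\<^esub> proj x = proj (r \<odot>\<^bsub>M\<^esub> x)"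
proof -
  have "proj (r \<odot>\<^bsub>M\<^esub> c) = proj (r \<odot>\<^bsub>M\<^esub> x)" if c: "c \<in> proj x" for c
  proof -
    have cM: "c \<in> carrier M" using c x a_r_coset_subset_G[OF a_subset] by blast
    have "c \<ominus>\<^bsub>M\<^esub> x \<in> N" using a_rcos_module[OF x cM] c by (simp add: a_minus_def)
    then have "r \<odot>\<^bsub>M\<^esub> (c \<ominus>\<^bsub>M\<^esub> x) \<in> N" using r by blast
    moreover have "r \<odot>\<^bsub>M\<^esub> (c \<ominus>\<^bsub>M\<^esub> x) = r \<odot>\<^bsub>M\<^esub> c \<ominus>\<^bsub>M\<^esub> r \<odot>\<^bsub>M\<^esub> x"
      using r x cM by (simp add: a_minus_def smult_r_distr smult_r_minus)
    ultimately show ?thesis using r x cM by (simp add: proj_eq_iff)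
  qed
  then have "(\<Union>c\<in>proj x. proj (r \<odot>\<^bsub>M\<^esub> c)) = (\<Union>c\<in>proj x. proj (r \<odot>\<^bsub>M\<^esub> x))"
    by (rule SUP_cong[OF refl])
  also have "\<dots> = proj (r \<odot>\<^bsub>M\<^esub> x)"
    using a_rcos_self[OF x] by (intro SUP_const) blast
  finally show ?thesis by (simp add: quotient_module_def)
qed

lemma quotient_module_module: "module R (quotient_module M N)"
proof (rule moduleI)
  show "abelian_group (quotient_module M N)"
  proof (rule abelian_groupI)
    show "\<exists>D\<in>carrier (quotient_module M N). D \<oplus>\<^bsub>quotient_module M N\<^esub> C = \<zero>\<^bsub>quotient_module M N\<^esub>"
      if C: "C \<in> carrier (quotient_module M N)" for C
    proof -
      obtain x where x: "x \<in> carrier M" "C = proj x" using C by (auto simp: carrier_quotient)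
      then have "proj (\<ominus>\<^bsub>M\<^esub> x) \<oplus>\<^bsub>quotient_module M N\<^esub> C = \<zero>\<^bsub>quotient_module M N\<^esub>"
        by (simp add: add_quotient zero_quotient M.l_neg del: a_coset_add_zero)
      then show ?thesis using x by (auto simp: carrier_quotient)
    qed
  qed (auto simp: carrier_quotient add_quotient zero_quotient M.a_ac
      simp del: a_coset_add_zero)
qed (auto simp: carrier_quotient add_quotient smult_quotient R.cring_axioms
    smult_l_distr smult_r_distr smult_assoc1)

lemma proj_hom: "proj \<in> module_hom R M (quotient_module M N)"
  by (rule module_homI) (auto simp: carrier_quotient add_quotient smult_quotient)

lemma proj_eq_zero_iff:
  assumes "x \<in> carrier M"
  shows "proj x = \<zero>\<^bsub>quotient_module M N\<^esub> \<longleftrightarrow> x \<in> N"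
  using assms a_coset_join1[OF _ assms a_subgroup] a_coset_join2[OF assms a_subgroup]
  by (auto simp: quotient_module_def)

text \<open>
  Two representatives of a coset differ by an element of \<open>N\<close>, where \<open>h\<close> vanishes; so the value of
  \<open>h\<close> at an arbitrary representative is a function of the coset.
\<close>

lemma quotient_factor:
  assumes "module R L" and h: "h \<in> module_hom R M L" and N: "\<forall>x\<in>N. h x = \<zero>\<^bsub>L\<^esub>"
  obtains u where "u \<in> module_hom R (quotient_module M N) L"
    and "\<And>x. x \<in> carrier M \<Longrightarrow> u (proj x) = h x"
proof -
  interpret L: module R L by fact
  define u where "u C = h (SOME x. x \<in> carrier M \<and> proj x = C)" for C
  have u: "u (proj x) = h x" if x: "x \<in> carrier M" for x
  proof -
    define y where "y = (SOME y. y \<in> carrier M \<and> proj y = proj x)"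
    have "y \<in> carrier M \<and> proj y = proj x"
      unfolding y_def by (rule someI[of _ x]) (use x in simp)
    then have y: "y \<in> carrier M" "y \<ominus>\<^bsub>M\<^esub> x \<in> N" using x by (auto simp: proj_eq_iff)
    have "h y \<ominus>\<^bsub>L\<^esub> h x = h (y \<ominus>\<^bsub>M\<^esub> x)"
      using x y module_hom_minus[OF module_axioms assms(1) h] by simp
    also have "\<dots> = \<zero>\<^bsub>L\<^esub>" using y N by simp
    finally have "h y = h x"
      using x y by (simp add: L.minus_eq_zero_iff module_hom_closed[OF h])
    then show ?thesis by (simp add: u_def y_def)
  qed
  have "u \<in> module_hom R (quotient_module M N) L"
    by (rule module_homI)
      (auto simp: carrier_quotient add_quotient smult_quotient u
        module_hom_closed[OF h] module_hom_add[OF h] module_hom_smult[OF h])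
  then show ?thesis using that u by blast
qed

end

section \<open>Log FW-derivations as linear maps that vanish on the relations\<close>

lemma (in prelog_ring) structure_map_closed: "x \<in> carrier Q \<Longrightarrow> \<alpha> x \<in> carrier R"
  using structure_map by (auto simp: monoid_hom_def hom_def)

lemma P_eval_closed:
  assumes "cring R" and "a \<in> carrier R" and "b \<in> carrier R"
  shows "P_eval p R a b \<in> carrier R"
proof -
  interpret cring R by fact
  show ?thesis
    unfolding P_eval_def using assms by (auto intro!: finsum_closed)
qed

text \<open>
  The elements of \<open>FDer\<close> are pairs of extensional maps, whereas composites with linear maps are not
  extensional; restriction mediates between the two. It is harmless because \<open>R\<close> and \<open>Q\<close> are closed
  under their operations and \<open>\<alpha>\<close> maps \<open>Q\<close> to \<open>R\<close>, so the defining equations mention values on the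
  carriers only.
\<close>

lemma restrict_log_FW_derivation:
  assumes "prelog_ring R Q \<alpha>"
  shows "log_FW_derivation p R Q \<alpha> M (restrict D (carrier R), restrict \<delta> (carrier Q)) \<longleftrightarrow>
    log_FW_derivation p R Q \<alpha> M (D, \<delta>)"
proof -
  interpret prelog_ring R Q \<alpha> by fact
  show ?thesis
    by (auto simp: log_FW_derivation_def FW_derivation_def monoid_hom_def hom_def
        structure_map_closed Pi_iff)
qed

lemma ball_Collect1: "(\<forall>s\<in>{f a | a. a \<in> A}. P s) \<longleftrightarrow> (\<forall>a\<in>A. P (f a))"
  by blast

lemma ball_Collect2: "(\<forall>s\<in>{f a b | a b. a \<in> A \<and> b \<in> B}. P s) \<longleftrightarrow> (\<forall>a\<in>A. \<forall>b\<in>B. P (f a b))"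
  by blast

context prelog_ring
begin

abbreviation F where "F \<equiv> FOmega_free R Q"
abbreviation dgen where "dgen a \<equiv> free_gen R (FOmega_gens R Q) (Inl a)"
abbreviation lgen where "lgen x \<equiv> free_gen R (FOmega_gens R Q) (Inr x)"

lemma gens_cases:
  "(\<forall>g\<in>FOmega_gens R Q. P g) \<longleftrightarrow> (\<forall>a\<in>carrier R. P (Inl a)) \<and> (\<forall>x\<in>carrier Q. P (Inr x))"
  by (auto simp: FOmega_gens_def)

lemma F_module: "module R F"
  unfolding FOmega_free_def by (rule free_module_module) (rule R.cring_axioms)

lemma gen_closed [simp]: "dgen a \<in> carrier F" "lgen x \<in> carrier F"
  unfolding FOmega_free_def by (rule free_gen_closed, rule R.cring_axioms)+

text \<open>
  Each relation is a difference of the two sides of one defining equation of a log FW-derivation,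
  or, for the unit of \<open>Q\<close>, the side that has to be zero. A linear map therefore kills it exactly
  if the equation holds for the images of the generators.
\<close>

lemma kills_rels_iff:
  assumes "module R M" and h: "h \<in> module_hom R F M"
  shows "(\<forall>s\<in>FOmega_rels p R Q \<alpha>. h s = \<zero>\<^bsub>M\<^esub>) \<longleftrightarrow>
    log_FW_derivation p R Q \<alpha> M (\<lambda>a. h (dgen a), \<lambda>x. h (lgen x))"
proof -
  interpret M: module R M by fact
  interpret F: module R F by (rule F_module)
  note hom = module_hom_closed[OF h] module_hom_add[OF h] module_hom_smult[OF h]
    module_hom_minus[OF F_module assms(1) h]
  note closed = P_eval_closed[OF R.cring_axioms] structure_map_closed
  have sum: "h (dgen (a \<oplus>\<^bsub>R\<^esub> b) \<ominus>\<^bsub>F\<^esub>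
        (dgen a \<oplus>\<^bsub>F\<^esub> dgen b \<ominus>\<^bsub>F\<^esub> P_eval p R a b \<odot>\<^bsub>F\<^esub> dgen ([p] \<cdot>\<^bsub>R\<^esub> \<one>\<^bsub>R\<^esub>))) = \<zero>\<^bsub>M\<^esub> \<longleftrightarrow>
      h (dgen (a \<oplus>\<^bsub>R\<^esub> b)) =
        h (dgen a) \<oplus>\<^bsub>M\<^esub> h (dgen b) \<ominus>\<^bsub>M\<^esub> P_eval p R a b \<odot>\<^bsub>M\<^esub> h (dgen ([p] \<cdot>\<^bsub>R\<^esub> \<one>\<^bsub>R\<^esub>))"
    if "a \<in> carrier R" "b \<in> carrier R" for a b
    using that closed by (simp add: hom M.minus_eq_zero_iff)
  have prod: "h (dgen (a \<otimes>\<^bsub>R\<^esub> b) \<ominus>\<^bsub>F\<^esub>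
        ((b [^]\<^bsub>R\<^esub> p) \<odot>\<^bsub>F\<^esub> dgen a \<oplus>\<^bsub>F\<^esub> (a [^]\<^bsub>R\<^esub> p) \<odot>\<^bsub>F\<^esub> dgen b)) = \<zero>\<^bsub>M\<^esub> \<longleftrightarrow>
      h (dgen (a \<otimes>\<^bsub>R\<^esub> b)) = (b [^]\<^bsub>R\<^esub> p) \<odot>\<^bsub>M\<^esub> h (dgen a) \<oplus>\<^bsub>M\<^esub> (a [^]\<^bsub>R\<^esub> p) \<odot>\<^bsub>M\<^esub> h (dgen b)"
    if "a \<in> carrier R" "b \<in> carrier R" for a b
    using that by (simp add: hom M.minus_eq_zero_iff)
  have mult: "h (lgen (x \<otimes>\<^bsub>Q\<^esub> y) \<ominus>\<^bsub>F\<^esub> (lgen x \<oplus>\<^bsub>F\<^esub> lgen y)) = \<zero>\<^bsub>M\<^esub> \<longleftrightarrow>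
      h (lgen (x \<otimes>\<^bsub>Q\<^esub> y)) = h (lgen x) \<oplus>\<^bsub>M\<^esub> h (lgen y)" for x y
    by (simp add: hom M.minus_eq_zero_iff)
  have log: "h (dgen (\<alpha> x) \<ominus>\<^bsub>F\<^esub> (\<alpha> x [^]\<^bsub>R\<^esub> p) \<odot>\<^bsub>F\<^esub> lgen x) = \<zero>\<^bsub>M\<^esub> \<longleftrightarrow>
      h (dgen (\<alpha> x)) = (\<alpha> x [^]\<^bsub>R\<^esub> p) \<odot>\<^bsub>M\<^esub> h (lgen x)" if "x \<in> carrier Q" for x
    using that closed by (simp add: hom M.minus_eq_zero_iff)
  have "(\<forall>s\<in>FOmega_rels p R Q \<alpha>. h s = \<zero>\<^bsub>M\<^esub>) \<longleftrightarrow>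
    (\<forall>a\<in>carrier R. \<forall>b\<in>carrier R. h (dgen (a \<oplus>\<^bsub>R\<^esub> b)) =
      h (dgen a) \<oplus>\<^bsub>M\<^esub> h (dgen b) \<ominus>\<^bsub>M\<^esub> P_eval p R a b \<odot>\<^bsub>M\<^esub> h (dgen ([p] \<cdot>\<^bsub>R\<^esub> \<one>\<^bsub>R\<^esub>))) \<and>
    (\<forall>a\<in>carrier R. \<forall>b\<in>carrier R. h (dgen (a \<otimes>\<^bsub>R\<^esub> b)) =
      (b [^]\<^bsub>R\<^esub> p) \<odot>\<^bsub>M\<^esub> h (dgen a) \<oplus>\<^bsub>M\<^esub> (a [^]\<^bsub>R\<^esub> p) \<odot>\<^bsub>M\<^esub> h (dgen b)) \<and>
    (\<forall>x\<in>carrier Q. \<forall>y\<in>carrier Q. h (lgen (x \<otimes>\<^bsub>Q\<^esub> y)) = h (lgen x) \<oplus>\<^bsub>M\<^esub> h (lgen y)) \<and>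
    h (lgen \<one>\<^bsub>Q\<^esub>) = \<zero>\<^bsub>M\<^esub> \<and>
    (\<forall>x\<in>carrier Q. h (dgen (\<alpha> x)) = (\<alpha> x [^]\<^bsub>R\<^esub> p) \<odot>\<^bsub>M\<^esub> h (lgen x))"
    unfolding FOmega_rels_def Let_def ball_Un ball_Collect2 ball_Collect1
    by (simp only: sum prod mult log ball_simps simp_thms conj_assoc cong: ball_cong)
  also have "\<dots> \<longleftrightarrow> log_FW_derivation p R Q \<alpha> M (\<lambda>a. h (dgen a), \<lambda>x. h (lgen x))"
    by (simp add: log_FW_derivation_def FW_derivation_def monoid_hom_def hom_def Pi_iff
        module_hom_closed[OF h])
  finally show ?thesis .
qed

lemma rels_subset: "FOmega_rels p R Q \<alpha> \<subseteq> carrier F"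
proof -
  interpret F: module R F by (rule F_module)
  show ?thesis
    by (auto simp: FOmega_rels_def Let_def P_eval_closed[OF R.cring_axioms] structure_map_closed)
qed

lemma FOmega_quotient: "module_quotient (FOmega_ker p R Q \<alpha>) R F"
  unfolding FOmega_ker_def
  by (intro module_quotient.intro F_module submodule_span_submodule rels_subset)

section \<open>The universal property\<close>

lemma FOmega_module: "module R (FOmega p R Q \<alpha>)"
  using module_quotient.quotient_module_module[OF FOmega_quotient] by (simp add: FOmega_def)

lemma projection_hom: "(\<lambda>f. FOmega_ker p R Q \<alpha> +>\<^bsub>F\<^esub> f) \<in> module_hom R F (FOmega p R Q \<alpha>)"
  using module_quotient.proj_hom[OF FOmega_quotient] by (simp add: FOmega_def)

lemma univ_w_closed: "a \<in> carrier R \<Longrightarrow> univ_w p R Q \<alpha> a \<in> carrier (FOmega p R Q \<alpha>)"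
  and univ_wlog_closed: "x \<in> carrier Q \<Longrightarrow> univ_wlog p R Q \<alpha> x \<in> carrier (FOmega p R Q \<alpha>)"
  using module_hom_closed[OF projection_hom gen_closed(1)]
    module_hom_closed[OF projection_hom gen_closed(2)]
  by (simp_all add: univ_w_def univ_wlog_def)

text \<open>
  The pair consists of the values on generators of the composite of \<open>u\<close> with the projection, and
  this composite vanishes on the relations since the projection does.
\<close>

lemma univ_map_log_FW_derivation:
  assumes "module R M" and u: "u \<in> module_hom R (FOmega p R Q \<alpha>) M"
  shows "log_FW_derivation p R Q \<alpha> M (univ_map p R Q \<alpha> u)"
proof -
  interpret quot: module_quotient "FOmega_ker p R Q \<alpha>" R F by (rule FOmega_quotient)
  let ?h = "\<lambda>f. u (FOmega_ker p R Q \<alpha> +>\<^bsub>F\<^esub> f)"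
  have h: "?h \<in> module_hom R F M"
    by (rule module_hom_comp[OF projection_hom u])
  have "?h s = \<zero>\<^bsub>M\<^esub>" if "s \<in> FOmega_rels p R Q \<alpha>" for s
  proof -
    have "s \<in> FOmega_ker p R Q \<alpha>"
      using that submodule_span_superset[of "FOmega_rels p R Q \<alpha>" R F] by (auto simp: FOmega_ker_def)
    then have "FOmega_ker p R Q \<alpha> +>\<^bsub>F\<^esub> s = \<zero>\<^bsub>FOmega p R Q \<alpha>\<^esub>"
      using quot.proj_eq_zero_iff[of s] quot.a_subset by (auto simp: FOmega_def)
    then show ?thesis
      using module_hom_zero[OF FOmega_module assms(1) u] by simp
  qed
  then have "log_FW_derivation p R Q \<alpha> M (\<lambda>a. ?h (dgen a), \<lambda>x. ?h (lgen x))"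
    using kills_rels_iff[OF assms(1) h] by blast
  moreover have "univ_map p R Q \<alpha> u =
      (restrict (\<lambda>a. ?h (dgen a)) (carrier R), restrict (\<lambda>x. ?h (lgen x)) (carrier Q))"
    by (auto simp: univ_map_def FDer_map_def compose_def univ_w_def univ_wlog_def intro!: restrict_ext)
  ultimately show ?thesis
    by (simp add: restrict_log_FW_derivation[OF prelog_ring_axioms])
qed

text \<open>The universal pair is what the identity of \<open>F\<Omega>\<close> corresponds to.\<close>

lemma univ_log_FW_derivation:
  "log_FW_derivation p R Q \<alpha> (FOmega p R Q \<alpha>) (univ_w p R Q \<alpha>, univ_wlog p R Q \<alpha>)"
proof -
  have "(\<lambda>C. C) \<in> module_hom R (FOmega p R Q \<alpha>) (FOmega p R Q \<alpha>)"
    by (simp add: module_hom_def)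
  from univ_map_log_FW_derivation[OF FOmega_module this]
  show ?thesis
    by (simp add: univ_map_def FDer_map_def compose_def
        restrict_log_FW_derivation[OF prelog_ring_axioms])
qed

text \<open>
  The composites of \<open>u\<close> and \<open>v\<close> with the projection agree on the generators of the free module,
  hence everywhere, and the projection is onto.
\<close>

lemma univ_map_inj:
  assumes "module R M"
    and u: "u \<in> module_hom R (FOmega p R Q \<alpha>) M" and v: "v \<in> module_hom R (FOmega p R Q \<alpha>) M"
    and eq: "univ_map p R Q \<alpha> u = univ_map p R Q \<alpha> v" and C: "C \<in> carrier (FOmega p R Q \<alpha>)"
  shows "u C = v C"
proof -
  interpret quot: module_quotient "FOmega_ker p R Q \<alpha>" R F by (rule FOmega_quotient)
  let ?pr = "\<lambda>f. FOmega_ker p R Q \<alpha> +>\<^bsub>F\<^esub> f"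
  let ?E = "{f \<in> carrier F. u (?pr f) = v (?pr f)}"
  have sub: "submodule ?E R F"
    by (rule equalizer_submodule[OF F_module assms(1)
          module_hom_comp[OF projection_hom u] module_hom_comp[OF projection_hom v]])
  have "u (?pr (dgen a)) = v (?pr (dgen a))" if "a \<in> carrier R" for a
    using eq that by (auto simp: univ_map_def FDer_map_def compose_def univ_w_def dest!: fun_cong[of _ _ a])
  moreover have "u (?pr (lgen x)) = v (?pr (lgen x))" if "x \<in> carrier Q" for x
    using eq that by (auto simp: univ_map_def FDer_map_def compose_def univ_wlog_def dest!: fun_cong[of _ _ x])
  ultimately have gens: "\<forall>g\<in>FOmega_gens R Q. free_gen R (FOmega_gens R Q) g \<in> ?E"
    by (auto simp: gens_cases)
  have "carrier F \<subseteq> ?E"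
    using free_module_generated[OF R.cring_axioms sub[unfolded FOmega_free_def] gens[unfolded FOmega_free_def]]
    unfolding FOmega_free_def .
  moreover obtain f where "f \<in> carrier F" "C = ?pr f"
    using C quot.carrier_quotient by (auto simp: FOmega_def)
  ultimately show ?thesis by auto
qed

text \<open>
  The linear extension of \<open>(D, \<delta>)\<close> to the free module vanishes on the relations, hence on the
  submodule that they generate.
\<close>

lemma univ_map_surj:
  assumes "module R M" and der: "log_FW_derivation p R Q \<alpha> M (D, \<delta>)"
    and ext: "D \<in> extensional (carrier R)" "\<delta> \<in> extensional (carrier Q)"
  obtains u where "u \<in> module_hom R (FOmega p R Q \<alpha>) M" and "univ_map p R Q \<alpha> u = (D, \<delta>)"
proof -
  interpret quot: module_quotient "FOmega_ker p R Q \<alpha>" R F by (rule FOmega_quotient)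
  have \<phi>: "case_sum D \<delta> \<in> FOmega_gens R Q \<rightarrow> carrier M"
    using der by (auto simp: log_FW_derivation_def FW_derivation_def monoid_hom_def hom_def FOmega_gens_def)
  define h where "h = free_ext R M (FOmega_gens R Q) (case_sum D \<delta>)"
  have h: "h \<in> module_hom R F M"
    unfolding h_def FOmega_free_def by (rule free_ext_hom[OF assms(1) \<phi>])
  have hD: "h (dgen a) = D a" if "a \<in> carrier R" for a
    using free_ext_gen[OF assms(1) \<phi>, of "Inl a"] that by (simp add: h_def FOmega_gens_def)
  have h\<delta>: "h (lgen x) = \<delta> x" if "x \<in> carrier Q" for x
    using free_ext_gen[OF assms(1) \<phi>, of "Inr x"] that by (simp add: h_def FOmega_gens_def)
  have restr: "restrict (\<lambda>a. h (dgen a)) (carrier R) = D" "restrict (\<lambda>x. h (lgen x)) (carrier Q) = \<delta>"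
    using ext by (auto simp: hD h\<delta> extensional_restrict cong: restrict_cong)
  have "log_FW_derivation p R Q \<alpha> M (\<lambda>a. h (dgen a), \<lambda>x. h (lgen x))"
    using der restrict_log_FW_derivation[OF prelog_ring_axioms,
        of p M "\<lambda>a. h (dgen a)" "\<lambda>x. h (lgen x)"] by (simp add: restr)
  then have "\<forall>s\<in>FOmega_rels p R Q \<alpha>. h s = \<zero>\<^bsub>M\<^esub>"
    using kills_rels_iff[OF assms(1) h] by blast
  then have "\<forall>f\<in>FOmega_ker p R Q \<alpha>. h f = \<zero>\<^bsub>M\<^esub>"
    using hom_zero_on_span[OF F_module assms(1) h rels_subset] unfolding FOmega_ker_def by blast
  then obtain u where u: "u \<in> module_hom R (FOmega p R Q \<alpha>) M"
    "\<And>f. f \<in> carrier F \<Longrightarrow> u (FOmega_ker p R Q \<alpha> +>\<^bsub>F\<^esub> f) = h f"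
    using quot.quotient_factor[OF assms(1) h] by (auto simp: FOmega_def)
  have "univ_map p R Q \<alpha> u = (D, \<delta>)"
    using u(2) restr
    by (auto simp: univ_map_def FDer_map_def compose_def univ_w_def univ_wlog_def cong: restrict_cong)
  with u(1) show ?thesis using that by blast
qed

lemma univ_map_linear:
  assumes "module R M"
  shows "univ_map p R Q \<alpha> \<in> module_hom R (Hom_module R (FOmega p R Q \<alpha>) M) (FDer p R Q \<alpha> M)"
proof (rule module_homI)
  fix u assume "u \<in> carrier (Hom_module R (FOmega p R Q \<alpha>) M)"
  then show "univ_map p R Q \<alpha> u \<in> carrier (FDer p R Q \<alpha> M)"
    using univ_map_log_FW_derivation[OF assms, of u p]
    by (auto simp: Hom_module_def FDer_def univ_map_def FDer_map_def)
qed (auto simp: Hom_module_def FDer_def univ_map_def FDer_map_def compose_def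
    univ_w_closed univ_wlog_closed intro!: restrict_ext)

lemma univ_map_iso:
  assumes "module R M"
  shows "univ_map p R Q \<alpha> \<in> module_iso R (Hom_module R (FOmega p R Q \<alpha>) M) (FDer p R Q \<alpha> M)"
proof -
  let ?H = "Hom_module R (FOmega p R Q \<alpha>) M" and ?D = "FDer p R Q \<alpha> M"
  have "inj_on (univ_map p R Q \<alpha>) (carrier ?H)"
    by (rule inj_onI)
      (auto simp: Hom_module_def intro!: extensionalityI[of _ "carrier (FOmega p R Q \<alpha>)"]
        univ_map_inj[OF assms])
  moreover have "d \<in> univ_map p R Q \<alpha> ` carrier ?H" if "d \<in> carrier ?D" for d
  proof -
    obtain D \<delta> where d: "d = (D, \<delta>)" by (cases d)
    from that have "log_FW_derivation p R Q \<alpha> M (D, \<delta>)"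
      "D \<in> extensional (carrier R)" "\<delta> \<in> extensional (carrier Q)"
      by (auto simp: d FDer_def)
    from univ_map_surj[OF assms this] obtain u
      where u: "u \<in> module_hom R (FOmega p R Q \<alpha>) M" "univ_map p R Q \<alpha> u = d"
      unfolding d .
    interpret Omega: module R "FOmega p R Q \<alpha>" by (rule FOmega_module)
    have "restrict u (carrier (FOmega p R Q \<alpha>)) \<in> carrier ?H"
      using u(1) by (auto simp: Hom_module_def module_hom_def)
    moreover have "univ_map p R Q \<alpha> (restrict u (carrier (FOmega p R Q \<alpha>))) = d"
      using u(2) by (auto simp: univ_map_def FDer_map_def compose_def univ_w_closed univ_wlog_closed
          cong: restrict_cong)
    ultimately show ?thesis by blast
  qed
  ultimately have "bij_betw (univ_map p R Q \<alpha>) (carrier ?H) (carrier ?D)"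
    using module_hom_closed[OF univ_map_linear[OF assms]]
    by (intro bij_betw_imageI equalityI image_subsetI subsetI)
  then show ?thesis
    by (simp add: module_iso_def univ_map_linear[OF assms])
qed

lemma univ_map_natural:
  "univ_map p R Q \<alpha> (compose (carrier (FOmega p R Q \<alpha>)) g u) = FDer_map R Q g (univ_map p R Q \<alpha> u)"
  by (auto simp: univ_map_def FDer_map_def compose_def univ_w_closed univ_wlog_closed intro!: restrict_ext)

end

theorem theorem3p4:
  fixes p :: nat
    and R :: "('r, 'c) ring_scheme"
    and Q :: "('q, 'e) monoid_scheme"
    and \<alpha> :: "'q \<Rightarrow> 'r"
  assumes "prime p"
    and "prelog_ring R Q \<alpha>"
  shows "module R (FOmega p R Q \<alpha>) \<and>
    log_FW_derivation p R Q \<alpha> (FOmega p R Q \<alpha>) (univ_w p R Q \<alpha>, univ_wlog p R Q \<alpha>) \<and>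
    (\<forall>M :: ('r, 'm, 'd) module_scheme. module R M \<longrightarrow>
      univ_map p R Q \<alpha> \<in> module_iso R (Hom_module R (FOmega p R Q \<alpha>) M) (FDer p R Q \<alpha> M)) \<and>
    (\<forall>(M :: ('r, 'm, 'd) module_scheme) (N :: ('r, 'n, 'f) module_scheme).
      module R M \<longrightarrow> module R N \<longrightarrow>
      (\<forall>g \<in> module_hom R M N. \<forall>u \<in> carrier (Hom_module R (FOmega p R Q \<alpha>) M).
        univ_map p R Q \<alpha> (compose (carrier (FOmega p R Q \<alpha>)) g u) =
        FDer_map R Q g (univ_map p R Q \<alpha> u)))"
proof -
  interpret prelog_ring R Q \<alpha> by fact
  show ?thesis
    using FOmega_module univ_log_FW_derivation univ_map_iso univ_map_natural by blast
qed

end
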